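(* Let $(\Omega, \mathcal{R})$ be a $d$-class association scheme with simultaneous eigenspaces $V_0, V_1, \ldots, V_d$ (where $V_0=\langle \mathds{1}\rangle$) and Krein parameters $q_{ij}^h$, and let $\theta$ be a subset of the vertices, such that its characteristic vector $\chi_\theta$ satisfies \[ \chi_\theta \in V_0 \perp \left(\perp_{\ell \in S} V_\ell\right), \] where $S \subseteq \{1, \ldots, d \}$. If there is some $h \in S$, such that $q_{i,j}^h=0$ for all $i, j \in S$, then \[ \chi_\theta \in V_0 \perp \left(\perp_{\ell \in S \backslash \{h\}} V_\ell\right), \] or $|\theta|=\frac{1}{2}|\Omega|$.
   Context: Here $\perp$ denotes orthogonal direct sum of subspaces, and $\perp_{\ell \in S} V_\ell$ denotes the orthogonal direct sum of the eigenspaces $V_\ell$ for $\ell\in S$. *)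

theory Defs
  imports "HOL-Analysis.Analysis"
begin

text \<open>
  The vertex set \<open>\<Omega>\<close> is the universe of a finite type. Association schemes are taken in
  Delsarte's sense, i.e. commutative but not necessarily symmetric; the symmetric ones are those
  with \<open>(R i)\<inverse> = R i\<close> for all \<open>i\<close>. Consequently all eigenspaces live in \<open>\<complex>\<^sup>\<Omega>\<close> with its
  Hermitian inner product.
\<close>

definition association_scheme :: "nat \<Rightarrow> (nat \<Rightarrow> ('a::finite \<times> 'a) set) \<Rightarrow> bool" where
  "association_scheme d R \<longleftrightarrow>
     R 0 = Id \<and>
     (\<forall>i\<le>d. R i \<noteq> {}) \<and>
     disjoint_family_on R {..d} \<and>
     (\<Union>i\<le>d. R i) = UNIV \<and>
     (\<forall>i\<le>d. \<exists>j\<le>d. (R i)\<inverse> = R j) \<and>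
     (\<exists>p :: nat \<Rightarrow> nat \<Rightarrow> nat \<Rightarrow> nat. \<forall>i\<le>d. \<forall>j\<le>d. \<forall>k\<le>d.
        p i j k = p j i k \<and>
        (\<forall>(x, y)\<in>R k. card {z. (x, z) \<in> R i \<and> (z, y) \<in> R j} = p i j k))"

definition adjacency_matrix :: "('a::finite \<times> 'a) set \<Rightarrow> complex^'a^'a" where
  "adjacency_matrix r = (\<chi> x y. if (x, y) \<in> r then 1 else 0)"

definition common_eigenspace ::
    "nat \<Rightarrow> (nat \<Rightarrow> ('a::finite \<times> 'a) set) \<Rightarrow> (nat \<Rightarrow> complex) \<Rightarrow> (complex^'a) set" where
  "common_eigenspace d R \<mu> = {v. \<forall>j\<le>d. adjacency_matrix (R j) *v v = \<mu> j *s v}"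

text \<open>
  \<open>V 0, \<dots>, V d\<close> enumerate, without repetition, all the nonzero common eigenspaces of the
  adjacency matrices, starting with the span of the all-one vector.
\<close>

definition simultaneous_eigenspaces ::
    "nat \<Rightarrow> (nat \<Rightarrow> ('a::finite \<times> 'a) set) \<Rightarrow> (nat \<Rightarrow> (complex^'a) set) \<Rightarrow> bool" where
  "simultaneous_eigenspaces d R V \<longleftrightarrow>
     bij_betw V {..d} {W. W \<noteq> {0} \<and> (\<exists>\<mu>. W = common_eigenspace d R \<mu>)} \<and>
     V 0 = vec.span {vec 1}"

definition hermitian_inner :: "complex^'a \<Rightarrow> complex^'a \<Rightarrow> complex" where
  "hermitian_inner u v = (\<Sum>x\<in>UNIV. u $ x * cnj (v $ x))"

definition orthogonal_projection :: "(complex^'a) set \<Rightarrow> complex^'a^'a" where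
  "orthogonal_projection W =
     (THE E. \<forall>v. E *v v \<in> W \<and> (\<forall>w\<in>W. hermitian_inner (v - E *v v) w = 0))"

text \<open>
  \<open>q i j h\<close> stands for the Krein parameter \<open>q\<^sub>i\<^sub>j\<^sup>h\<close>, the coefficients in
  \<open>E\<^sub>i \<circ> E\<^sub>j = 1/|\<Omega>| \<Sum>\<^sub>h q\<^sub>i\<^sub>j\<^sup>h E\<^sub>h\<close>, where \<open>\<circ>\<close> is the entrywise product and \<open>E\<^sub>i\<close> is the
  orthogonal projection onto \<open>V\<^sub>i\<close>. As the \<open>E\<^sub>h\<close> are linearly independent, this determines
  \<open>q i j h\<close> for all \<open>i, j, h \<le> d\<close>.
\<close>

definition krein_parameters ::
    "nat \<Rightarrow> (nat \<Rightarrow> (complex^'a) set) \<Rightarrow> (nat \<Rightarrow> nat \<Rightarrow> nat \<Rightarrow> complex) \<Rightarrow> bool" where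
  "krein_parameters d V q \<longleftrightarrow>
     (\<forall>i\<le>d. \<forall>j\<le>d. \<forall>x y.
        orthogonal_projection (V i) $ x $ y * orthogonal_projection (V j) $ x $ y =
        1 / of_nat CARD('a) * (\<Sum>h\<le>d. q i j h * orthogonal_projection (V h) $ x $ y))"

text \<open>
  Distinct simultaneous eigenspaces of a commutative scheme are mutually orthogonal, so for these
  the following sum of subspaces is the orthogonal direct sum.
\<close>

definition subspace_sum :: "(nat \<Rightarrow> (complex^'a) set) \<Rightarrow> nat set \<Rightarrow> (complex^'a) set" where
  "subspace_sum V I = {\<Sum>l\<in>I. f l | f. \<forall>l\<in>I. f l \<in> V l}"

definition characteristic_vector :: "'a set \<Rightarrow> complex^'a" where
  "characteristic_vector T = (\<chi> x. indicator T x)"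

end

theory Submission
  imports Defs
begin

text \<open>
  If \<open>q i j h = 0\<close>, then \<open>E\<^sub>h (u \<circ> v) = 0\<close> for all \<open>u \<in> V i\<close> and \<open>v \<in> V j\<close>: with \<open>D\<close> the
  restriction of tensors to the diagonal, so that \<open>u \<circ> v = D (u \<otimes> v)\<close>, the operator
  \<open>M = E\<^sub>h D (E\<^sub>i \<otimes> E\<^sub>j)\<close> satisfies \<open>M M\<^sup>* = E\<^sub>h (E\<^sub>i \<circ> E\<^sub>j) E\<^sub>h = q i j h / |\<Omega>| E\<^sub>h\<close>, whence \<open>M = 0\<close>.
  Now write \<open>\<chi> = c \<one> + \<Sum>\<^sub>l v\<^sub>l\<close> with \<open>c = |\<theta>| / |\<Omega>|\<close> and apply \<open>E\<^sub>h\<close> to \<open>\<chi> = \<chi> \<circ> \<chi>\<close>. All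
  products \<open>v\<^sub>i \<circ> v\<^sub>j\<close> are killed, which leaves \<open>v\<^sub>h = 2 c v\<^sub>h\<close>.
\<close>

section \<open>The Hermitian inner product\<close>

lemma hermitian_inner_add_left: "hermitian_inner (u + v) w = hermitian_inner u w + hermitian_inner v w"
  by (simp add: hermitian_inner_def sum.distrib algebra_simps)

lemma hermitian_inner_diff_left: "hermitian_inner (u - v) w = hermitian_inner u w - hermitian_inner v w"
  by (simp add: hermitian_inner_def sum_subtractf algebra_simps)

lemma hermitian_inner_scale_left: "hermitian_inner (a *s u) v = a * hermitian_inner u v"
  by (simp add: hermitian_inner_def sum_distrib_left algebra_simps)

lemma hermitian_inner_scale_right: "hermitian_inner u (a *s v) = cnj a * hermitian_inner u v"
  by (simp add: hermitian_inner_def sum_distrib_left algebra_simps)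

lemma cnj_hermitian_inner: "cnj (hermitian_inner u v) = hermitian_inner v u"
  by (simp add: hermitian_inner_def mult.commute)

lemma hermitian_inner_zero_left [simp]: "hermitian_inner 0 v = 0"
  by (simp add: hermitian_inner_def)

lemma Re_hermitian_inner: "Re (hermitian_inner u v) = u \<bullet> v"
  by (simp add: hermitian_inner_def inner_vec_def inner_complex_def)

lemma hermitian_inner_self_eq_0_iff: "hermitian_inner u u = 0 \<longleftrightarrow> u = 0"
  by (metis Re_hermitian_inner inner_eq_zero_iff hermitian_inner_zero_left zero_complex.sel(1))

lemma hermitian_inner_axis_right: "hermitian_inner u (axis x 1) = u $ x"
  by (simp add: hermitian_inner_def axis_def if_distrib[of cnj] if_distrib[of "(*) _"] cong: if_cong)

section \<open>Orthogonal projections\<close>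

text \<open>A complex subspace is also a real one, and the real inner product is the real part of
  the Hermitian one. So the real orthogonal decomposition applies, and only the imaginary part of
  orthogonality remains to be recovered.\<close>

lemma hermitian_decomposition_exists:
  fixes W :: "(complex^'a::finite) set"
  assumes W: "vec.subspace W"
  obtains y where "y \<in> W" "\<And>w. w \<in> W \<Longrightarrow> hermitian_inner (v - y) w = 0"
proof -
  have scale: "c *\<^sub>R x = complex_of_real c *s x" for c and x :: "complex^'a"
    unfolding vec_eq_iff vector_scaleR_component vector_smult_component
    by (simp add: scaleR_conv_of_real)
  have "subspace W"
    unfolding subspace_def scale
    using W by (auto intro: vec.subspace_0 vec.subspace_add vec.subspace_scale)
  then have "span W = W"
    by simp
  then obtain y z where yz: "y \<in> W" "\<And>w. w \<in> W \<Longrightarrow> orthogonal z w" "v = y + z"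
    using orthogonal_subspace_decomp_exists[of W v] by metis
  have "hermitian_inner (v - y) w = 0" if w: "w \<in> W" for w
  proof -
    \<comment> \<open>The real part of the product of \<open>z\<close> with \<open>\<i> *s w\<close>
      is the imaginary part of its product with \<open>w\<close>.\<close>
    have "\<i> *s w \<in> W"
      using W w by (rule vec.subspace_scale)
    then have "Re (hermitian_inner z (\<i> *s w)) = 0"
      using yz(2) unfolding Re_hermitian_inner orthogonal_def by blast
    then have "Im (hermitian_inner z w) = 0"
      by (simp add: hermitian_inner_scale_right)
    moreover have "Re (hermitian_inner z w) = 0"
      using yz(2) w unfolding Re_hermitian_inner orthogonal_def by blast
    ultimately show ?thesis
      using yz(3) by (simp add: complex_eq_iff)
  qed
  with yz(1) show thesis
    by (rule that)
qed

lemma hermitian_decomposition_unique: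
  fixes W :: "(complex^'a::finite) set"
  assumes W: "vec.subspace W" and "y \<in> W" "y' \<in> W"
    and "\<And>w. w \<in> W \<Longrightarrow> hermitian_inner (v - y) w = 0"
    and "\<And>w. w \<in> W \<Longrightarrow> hermitian_inner (v - y') w = 0"
  shows "y = y'"
proof -
  have "y - y' \<in> W"
    using assms by (simp add: vec.subspace_diff)
  then have "hermitian_inner ((v - y') - (v - y)) (y - y') = 0"
    using assms(4,5) by (simp add: hermitian_inner_diff_left)
  then show ?thesis
    by (simp add: hermitian_inner_self_eq_0_iff)
qed

text \<open>This discharges the definite description. Pointwise choice gives a map \<open>p\<close>;
  uniqueness of the decomposition forces \<open>p\<close> to be linear, so its matrix satisfies the
  description and is the only one to do so.\<close>

lemma orthogonal_projection:
  fixes W :: "(complex^'a::finite) set"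
  assumes W: "vec.subspace W"
  shows "orthogonal_projection W *v v \<in> W"
    and "w \<in> W \<Longrightarrow> hermitian_inner (v - orthogonal_projection W *v v) w = 0"
proof -
  let ?P = "\<lambda>E. \<forall>v. E *v v \<in> W \<and> (\<forall>w\<in>W. hermitian_inner (v - E *v v) w = 0)"
  have "\<forall>v. \<exists>y. y \<in> W \<and> (\<forall>w\<in>W. hermitian_inner (v - y) w = 0)"
    using hermitian_decomposition_exists[OF W] by metis
  then obtain p where p: "\<And>v. p v \<in> W"
      "\<And>v w. w \<in> W \<Longrightarrow> hermitian_inner (v - p v) w = 0"
    by metis
  have "Vector_Spaces.linear (*s) (*s) p"
  proof (rule Vector_Spaces.linear_iff[THEN iffD2], intro conjI allI)
    show "vector_space ((*s) :: complex \<Rightarrow> complex^'a \<Rightarrow> _)"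
      by (rule vec.vector_space_axioms)
    then show "vector_space ((*s) :: complex \<Rightarrow> complex^'a \<Rightarrow> _)" .
  next
    fix u v
    show "p (u + v) = p u + p v"
    proof (rule hermitian_decomposition_unique[OF W, where v = "u + v"])
      fix w assume "w \<in> W"
      moreover have "(u + v) - (p u + p v) = (u - p u) + (v - p v)"
        by simp
      ultimately show "hermitian_inner ((u + v) - (p u + p v)) w = 0"
        using p(2) by (simp only: hermitian_inner_add_left add_0)
    qed (use p W in \<open>auto intro: vec.subspace_add\<close>)
  next
    fix c v
    show "p (c *s v) = c *s p v"
    proof (rule hermitian_decomposition_unique[OF W, where v = "c *s v"])
      fix w assume "w \<in> W"
      moreover have "c *s v - c *s p v = c *s (v - p v)"
        by (simp add: vec.scale_right_diff_distrib)
      ultimately show "hermitian_inner (c *s v - c *s p v) w = 0"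
        using p(2) by (simp only: hermitian_inner_scale_left mult_zero_right)
    qed (use p W in \<open>auto intro: vec.subspace_scale\<close>)
  qed
  then have mp: "matrix p *v v = p v" for v
    by (rule matrix_works)
  have "?P (matrix p)"
    using p by (simp add: mp)
  moreover have "E = matrix p" if "?P E" for E
    unfolding matrix_eq mp
    using that p by (blast intro: hermitian_decomposition_unique[OF W])
  ultimately have "?P (orthogonal_projection W)"
    unfolding orthogonal_projection_def by (rule theI)
  then show "orthogonal_projection W *v v \<in> W"
    and "w \<in> W \<Longrightarrow> hermitian_inner (v - orthogonal_projection W *v v) w = 0"
    by auto
qed

lemma orthogonal_projection_eqI:
  fixes W :: "(complex^'a::finite) set"
  assumes "vec.subspace W" "y \<in> W" "\<And>w. w \<in> W \<Longrightarrow> hermitian_inner (v - y) w = 0"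
  shows "orthogonal_projection W *v v = y"
  using assms orthogonal_projection[OF assms(1)]
  by (blast intro: hermitian_decomposition_unique[OF assms(1)])

lemma orthogonal_projection_id:
  fixes W :: "(complex^'a::finite) set"
  assumes "vec.subspace W" "v \<in> W"
  shows "orthogonal_projection W *v v = v"
  using assms by (intro orthogonal_projection_eqI) auto

text \<open>Projections are self-adjoint: moving \<open>?E\<close> across the inner product passes
  through the symmetric form with \<open>?E\<close> on both sides. Standard basis vectors then read
  off the entries.\<close>

lemma orthogonal_projection_entry_cnj:
  fixes W :: "(complex^'a::finite) set"
  assumes W: "vec.subspace W"
  shows "cnj (orthogonal_projection W $ x $ y) = orthogonal_projection W $ y $ x"
proof -
  let ?E = "orthogonal_projection W"
  have left: "hermitian_inner (?E *v u) (?E *v v) = hermitian_inner u (?E *v v)" for u v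
    using orthogonal_projection(2)[OF W orthogonal_projection(1)[OF W], of u v]
    by (simp add: hermitian_inner_diff_left)
  then have "hermitian_inner (?E *v u) v = hermitian_inner u (?E *v v)" for u v
    using orthogonal_projection(2)[OF W orthogonal_projection(1)[OF W], of v u]
    by (metis cnj_hermitian_inner)
  then have "hermitian_inner (?E *v axis y 1) (axis x 1) = cnj (hermitian_inner (?E *v axis x 1) (axis y 1))"
    by (metis cnj_hermitian_inner)
  then show ?thesis
    unfolding hermitian_inner_axis_right
    by (simp add: matrix_vector_mult_def axis_def if_distrib[of "(*) _"] cong: if_cong)
qed

lemma orthogonal_projection_entry_idem:
  fixes W :: "(complex^'a::finite) set"
  assumes W: "vec.subspace W"
  shows "(\<Sum>z\<in>UNIV. orthogonal_projection W $ x $ z * orthogonal_projection W $ z $ y) =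
    orthogonal_projection W $ x $ y"
proof -
  let ?E = "orthogonal_projection W"
  have "?E ** ?E = ?E"
    by (simp add: matrix_eq orthogonal_projection_id[OF W] orthogonal_projection(1)[OF W]
        flip: matrix_vector_mul_assoc)
  then have "(?E ** ?E) $ x $ y = ?E $ x $ y"
    by simp
  then show ?thesis
    by (simp add: matrix_matrix_mult_def)
qed

section \<open>Vanishing Krein parameters\<close>

lemma sum_swap_pairs:
  "(\<Sum>y\<in>A. \<Sum>z\<in>B. \<Sum>x\<in>C. \<Sum>x'\<in>D. g y z x x') =
   (\<Sum>x\<in>C. \<Sum>x'\<in>D. \<Sum>y\<in>A. \<Sum>z\<in>B. g y z x x')"
proof -
  have "(\<Sum>y\<in>A. \<Sum>z\<in>B. \<Sum>x\<in>C. \<Sum>x'\<in>D. g y z x x') =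
      (\<Sum>y\<in>A. \<Sum>x\<in>C. \<Sum>z\<in>B. \<Sum>x'\<in>D. g y z x x')"
    by (intro sum.cong refl sum.swap)
  also have "\<dots> = (\<Sum>x\<in>C. \<Sum>y\<in>A. \<Sum>z\<in>B. \<Sum>x'\<in>D. g y z x x')"
    by (rule sum.swap)
  also have "\<dots> = (\<Sum>x\<in>C. \<Sum>y\<in>A. \<Sum>x'\<in>D. \<Sum>z\<in>B. g y z x x')"
    by (intro sum.cong refl sum.swap)
  also have "\<dots> = (\<Sum>x\<in>C. \<Sum>x'\<in>D. \<Sum>y\<in>A. \<Sum>z\<in>B. g y z x x')"
    by (intro sum.cong refl sum.swap)
  finally show ?thesis .
qed

text \<open>The assumption on \<open>w\<close> says that the quadratic form of the entrywise product
  of the two projections vanishes at \<open>w\<close>. This form is the squared norm of a tensor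
  \<open>T\<close>, and the claimed sum is the pairing of the tensor product of \<open>u\<close> and
  \<open>v\<close> with \<open>T\<close>.\<close>

lemma hermitian_inner_product_eq_0:
  fixes U V :: "(complex^'a::finite) set"
  assumes U: "vec.subspace U" and V: "vec.subspace V"
    and w: "(\<Sum>x\<in>UNIV. \<Sum>y\<in>UNIV. cnj (w $ x) *
      (orthogonal_projection U $ x $ y * orthogonal_projection V $ x $ y) * w $ y) = 0"
    and u: "u \<in> U" and v: "v \<in> V"
  shows "(\<Sum>x\<in>UNIV. u $ x * v $ x * cnj (w $ x)) = 0"
proof -
  let ?E = "\<lambda>x y. orthogonal_projection U $ x $ y"
  let ?F = "\<lambda>x y. orthogonal_projection V $ x $ y"
  \<comment> \<open>\<open>T\<close> is the tensor product of the projections applied to the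
    diagonal tensor with entries \<open>w $ x\<close>, that is, the adjoint of \<open>M\<close> from
    the introduction, at \<open>w\<close>.\<close>
  define T where "T y z = (\<Sum>x\<in>UNIV. ?E y x * ?F z x * w $ x)" for y z
  have cnjT: "cnj (T y z) = (\<Sum>x\<in>UNIV. ?E x y * ?F x z * cnj (w $ x))" for y z
    by (simp add: T_def orthogonal_projection_entry_cnj[OF U] orthogonal_projection_entry_cnj[OF V])
  have "(\<Sum>y\<in>UNIV. \<Sum>z\<in>UNIV. cnj (T y z) * T y z) =
      (\<Sum>y\<in>UNIV. \<Sum>z\<in>UNIV. \<Sum>x\<in>UNIV. \<Sum>x'\<in>UNIV.
        cnj (w $ x) * w $ x' * (?E x y * ?E y x') * (?F x z * ?F z x'))"
    unfolding cnjT unfolding T_def sum_product by (simp add: mult_ac)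
  also have "\<dots> = (\<Sum>x\<in>UNIV. \<Sum>x'\<in>UNIV. \<Sum>y\<in>UNIV. \<Sum>z\<in>UNIV.
        cnj (w $ x) * w $ x' * (?E x y * ?E y x') * (?F x z * ?F z x'))"
    by (rule sum_swap_pairs)
  also have "\<dots> = (\<Sum>x\<in>UNIV. \<Sum>x'\<in>UNIV.
        cnj (w $ x) * w $ x' * (\<Sum>y\<in>UNIV. ?E x y * ?E y x') * (\<Sum>z\<in>UNIV. ?F x z * ?F z x'))"
    by (simp add: sum_distrib_left sum_distrib_right mult_ac)
  \<comment> \<open>Idempotence collapses each inner sum to one entry of \<open>?E\<close> or
    \<open>?F\<close>, which leaves the quadratic form assumed to be zero.\<close>
  also have "\<dots> = 0"
    using w by (simp add: orthogonal_projection_entry_idem[OF U] orthogonal_projection_entry_idem[OF V] mult_ac)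
  finally have "(\<Sum>y\<in>UNIV. \<Sum>z\<in>UNIV. cnj (T y z) * T y z) = 0" .
  then have "complex_of_real (\<Sum>y\<in>UNIV. \<Sum>z\<in>UNIV. (cmod (T y z))\<^sup>2) = 0"
    by (simp only: of_real_sum complex_norm_square mult.commute)
  then have "(\<Sum>y\<in>UNIV. \<Sum>z\<in>UNIV. (cmod (T y z))\<^sup>2) = 0"
    by (simp only: of_real_eq_0_iff)
  then have T0: "T y z = 0" for y z
    by (simp add: sum_nonneg_eq_0_iff sum_nonneg)
  \<comment> \<open>Since the projections fix \<open>u\<close> and \<open>v\<close>, they can be
    inserted into the product, which makes \<open>T\<close> appear.\<close>
  have ux: "u $ x = (\<Sum>y\<in>UNIV. ?E x y * u $ y)" for x
    using arg_cong[OF orthogonal_projection_id[OF U u], of "\<lambda>a. a $ x"]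
    by (simp add: matrix_vector_mult_def)
  have vx: "v $ x = (\<Sum>y\<in>UNIV. ?F x y * v $ y)" for x
    using arg_cong[OF orthogonal_projection_id[OF V v], of "\<lambda>a. a $ x"]
    by (simp add: matrix_vector_mult_def)
  have "(\<Sum>x\<in>UNIV. u $ x * v $ x * cnj (w $ x)) =
     (\<Sum>x\<in>UNIV. \<Sum>y\<in>UNIV. \<Sum>z\<in>UNIV. u $ y * v $ z * (?E x y * ?F x z * cnj (w $ x)))"
    by (subst ux, subst vx, unfold sum_product, unfold sum_distrib_right) (simp add: mult_ac)
  also have "\<dots> = (\<Sum>y\<in>UNIV. \<Sum>z\<in>UNIV. \<Sum>x\<in>UNIV. u $ y * v $ z * (?E x y * ?F x z * cnj (w $ x)))"
    by (subst sum.swap, rule sum.cong[OF refl], rule sum.swap)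
  also have "\<dots> = (\<Sum>y\<in>UNIV. \<Sum>z\<in>UNIV. u $ y * v $ z * cnj (T y z))"
    by (simp add: cnjT sum_distrib_left)
  finally show ?thesis
    by (simp add: T0)
qed

text \<open>Expanding the entrywise product of two projections by Krein parameters and applying it
  to \<open>w\<close> leaves only the term for \<open>h\<close>, because \<open>w\<close> is
  orthogonal to the other eigenspaces; that term carries the coefficient
  \<open>q i j h = 0\<close>.\<close>

lemma krein_parameter_zero:
  fixes V :: "nat \<Rightarrow> (complex^'a::finite) set"
  assumes sub: "\<And>l. l \<le> d \<Longrightarrow> vec.subspace (V l)"
    and orth: "\<And>k l u v. k \<le> d \<Longrightarrow> l \<le> d \<Longrightarrow> k \<noteq> l \<Longrightarrow> u \<in> V k \<Longrightarrow> v \<in> V l \<Longrightarrow>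
      hermitian_inner u v = 0"
    and krein: "krein_parameters d V q"
    and le: "i \<le> d" "j \<le> d" "h \<le> d" and q0: "q i j h = 0"
    and "u \<in> V i" "v \<in> V j" and w: "w \<in> V h"
  shows "(\<Sum>x\<in>UNIV. u $ x * v $ x * cnj (w $ x)) = 0"
proof (rule hermitian_inner_product_eq_0[OF sub sub])
  let ?E = "\<lambda>l. orthogonal_projection (V l)"
  have Ew: "?E l *v w = 0" if "l \<le> d" "l \<noteq> h" for l
    using that le w orth by (intro orthogonal_projection_eqI sub) (auto simp: vec.subspace_0 sub)
  have "(\<Sum>y\<in>UNIV. cnj (w $ x) * (?E i $ x $ y * ?E j $ x $ y) * w $ y) = 0" for x
  proof -
    have "(\<Sum>y\<in>UNIV. cnj (w $ x) * (?E i $ x $ y * ?E j $ x $ y) * w $ y) =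
        (\<Sum>y\<in>UNIV. \<Sum>l\<le>d. cnj (w $ x) * (1 / of_nat CARD('a)) * q i j l * (?E l $ x $ y * w $ y))"
      using krein le unfolding krein_parameters_def
      by (simp add: sum_distrib_left sum_distrib_right mult_ac sum_divide_distrib)
    also have "\<dots> = (\<Sum>l\<le>d. cnj (w $ x) * (1 / of_nat CARD('a)) * q i j l * (?E l *v w) $ x)"
      by (subst sum.swap) (simp add: matrix_vector_mult_def sum_distrib_left)
    also have "\<dots> = 0"
      using Ew q0 by (intro sum.neutral ballI) (metis atMost_iff mult_eq_0_iff zero_index)
    finally show ?thesis .
  qed
  then show "(\<Sum>x\<in>UNIV. \<Sum>y\<in>UNIV. cnj (w $ x) * (?E i $ x $ y * ?E j $ x $ y) * w $ y) = 0"
    by simp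
qed (use assms in auto)

section \<open>Common eigenspaces of an association scheme\<close>

lemma subspace_common_eigenspace: "vec.subspace (common_eigenspace d R \<mu>)"
  by (auto simp: vec.subspace_def common_eigenspace_def matrix_vector_right_distrib
      vec.scale_right_distrib vec.scale mult.commute)

lemma hermitian_inner_adjacency_matrix:
  "hermitian_inner (adjacency_matrix r *v u) v = hermitian_inner u (adjacency_matrix (r\<inverse>) *v v)"
proof -
  have "hermitian_inner (adjacency_matrix r *v u) v =
      (\<Sum>x\<in>UNIV. \<Sum>y\<in>UNIV. adjacency_matrix r $ x $ y * u $ y * cnj (v $ x))"
    by (simp add: hermitian_inner_def matrix_vector_mult_def sum_distrib_right)
  also have "\<dots> = (\<Sum>y\<in>UNIV. \<Sum>x\<in>UNIV. adjacency_matrix r $ x $ y * u $ y * cnj (v $ x))"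
    by (rule sum.swap)
  also have "\<dots> = hermitian_inner u (adjacency_matrix (r\<inverse>) *v v)"
    by (auto simp: hermitian_inner_def matrix_vector_mult_def sum_distrib_left adjacency_matrix_def
        intro!: sum.cong)
  finally show ?thesis .
qed

text \<open>The adjoint of an adjacency matrix is that of the converse relation, again in the
  scheme. If the inner product of \<open>u\<close> and \<open>v\<close> is nonzero, both
  \<open>\<mu> i\<close> and \<open>\<nu> i\<close> must equal the conjugate eigenvalue of
  \<open>v\<close> for the converse of \<open>R i\<close>.\<close>

lemma common_eigenspaces_orthogonal:
  fixes R :: "nat \<Rightarrow> ('a::finite \<times> 'a) set"
  assumes conv: "\<forall>i\<le>d. \<exists>j\<le>d. (R i)\<inverse> = R j"
    and ne: "common_eigenspace d R \<mu> \<noteq> common_eigenspace d R \<nu>"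
    and u: "u \<in> common_eigenspace d R \<mu>" and v: "v \<in> common_eigenspace d R \<nu>"
  shows "hermitian_inner u v = 0"
proof (rule ccontr)
  assume uv: "hermitian_inner u v \<noteq> 0"
  then have v0: "hermitian_inner v v \<noteq> 0"
    by (metis cnj_hermitian_inner complex_cnj_zero hermitian_inner_self_eq_0_iff hermitian_inner_zero_left)
  have "\<mu> i = \<nu> i" if i: "i \<le> d" for i
  proof -
    from conv i obtain j where j: "j \<le> d" "(R i)\<inverse> = R j"
      by blast
    have *: "\<rho> i * hermitian_inner x v = cnj (\<nu> j) * hermitian_inner x v"
      if "x \<in> common_eigenspace d R \<rho>" for x \<rho>
      using hermitian_inner_adjacency_matrix[of "R i" x v] that v i j
      by (simp add: common_eigenspace_def hermitian_inner_scale_left hermitian_inner_scale_right)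
    show ?thesis
      using *[OF u] *[OF v] uv v0 by simp
  qed
  then have "common_eigenspace d R \<mu> = common_eigenspace d R \<nu>"
    by (simp add: common_eigenspace_def)
  with ne show False ..
qed

lemma simultaneous_eigenspaces_subspace:
  assumes "simultaneous_eigenspaces d R V" "l \<le> d"
  shows "vec.subspace (V l)"
proof -
  obtain \<mu> where "V l = common_eigenspace d R \<mu>"
    using assms bij_betwE[of V "{..d}"] unfolding simultaneous_eigenspaces_def by fastforce
  then show ?thesis
    by (simp add: subspace_common_eigenspace)
qed

lemma simultaneous_eigenspaces_orthogonal:
  assumes "association_scheme d R" "simultaneous_eigenspaces d R V"
    and "k \<le> d" "l \<le> d" "k \<noteq> l" "u \<in> V k" "v \<in> V l"
  shows "hermitian_inner u v = 0"
proof -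
  have bij: "bij_betw V {..d} {W. W \<noteq> {0} \<and> (\<exists>\<mu>. W = common_eigenspace d R \<mu>)}"
    using assms(2) by (simp add: simultaneous_eigenspaces_def)
  have "V k \<noteq> V l"
    using bij assms by (auto simp: bij_betw_def inj_on_def)
  moreover obtain \<mu> \<nu> where "V k = common_eigenspace d R \<mu>" "V l = common_eigenspace d R \<nu>"
    using bij_betwE[OF bij] assms(3,4) by fastforce
  moreover have "\<forall>i\<le>d. \<exists>j\<le>d. (R i)\<inverse> = R j"
    using assms(1) by (simp add: association_scheme_def)
  ultimately show ?thesis
    using assms(6,7) common_eigenspaces_orthogonal[of d R \<mu> \<nu> u v] by simp
qed

section \<open>The component of the characteristic vector in \<open>V h\<close>\<close>

theorem theorem1p3:
  fixes d :: nat
    and R :: "nat \<Rightarrow> ('a::finite \<times> 'a) set"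
    and V :: "nat \<Rightarrow> (complex^'a) set"
    and q :: "nat \<Rightarrow> nat \<Rightarrow> nat \<Rightarrow> complex"
    and \<theta> :: "'a set" and S :: "nat set" and h :: nat
  assumes "association_scheme d R"
    and "simultaneous_eigenspaces d R V"
    and "krein_parameters d V q"
    and "S \<subseteq> {1..d}"
    and "characteristic_vector \<theta> \<in> subspace_sum V (insert 0 S)"
    and "h \<in> S"
    and "\<forall>i\<in>S. \<forall>j\<in>S. q i j h = 0"
  shows "characteristic_vector \<theta> \<in> subspace_sum V (insert 0 (S - {h})) \<or>
         real (card \<theta>) = 1 / 2 * real CARD('a)"
proof -
  note sub = simultaneous_eigenspaces_subspace[OF assms(2)]
  note orth = simultaneous_eigenspaces_orthogonal[OF assms(1,2)]
  have S: "finite S" "0 \<notin> S" "\<And>l. l \<in> S \<Longrightarrow> l \<le> d"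
    using assms(4) finite_subset by fastforce+
  obtain f where f: "characteristic_vector \<theta> = (\<Sum>l\<in>insert 0 S. f l)"
      "\<And>l. l \<in> insert 0 S \<Longrightarrow> f l \<in> V l"
    using assms(5) unfolding subspace_sum_def by auto
  have V0: "V 0 = vec.span {vec 1}"
    using assms(2) by (simp add: simultaneous_eigenspaces_def)
  then have one: "vec 1 \<in> V 0"
    by (simp add: vec.span_base)
  from f(2)[of 0] V0 obtain c where c: "f 0 = c *s vec 1"
    by (auto simp: vec.span_singleton)
  define s where "s x = (\<Sum>l\<in>S. f l $ x)" for x
  have chi: "indicator \<theta> x = c + s x" for x
    using arg_cong[OF f(1), of "\<lambda>v. v $ x"] S c
    by (simp add: characteristic_vector_def s_def)
  \<comment> \<open>Orthogonality to the all-one vector in \<open>V 0\<close>. It makes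
    \<open>s\<close> sum to zero, so that \<open>c\<close> is the density of
    \<open>\<theta>\<close>.\<close>
  have f_sum0: "(\<Sum>x\<in>UNIV. f l $ x) = 0" if "l \<in> S" for l
    using orth[of l 0 "f l" "vec 1"] that S f(2) one
    by (auto simp: hermitian_inner_def)
  have "(\<Sum>x\<in>UNIV. s x) = 0"
    unfolding s_def by (subst sum.swap) (simp add: f_sum0)
  moreover have "complex_of_nat (card \<theta>) = (\<Sum>x\<in>UNIV. indicator \<theta> x)"
    by (simp add: indicator_def of_bool_def sum.If_cases)
  ultimately have card: "complex_of_nat (card \<theta>) = c * of_nat CARD('a)"
    by (simp add: chi sum.distrib)
  \<comment> \<open>Pairing with \<open>f h\<close> stands in for applying the projection onto
    \<open>V h\<close>: constants vanish and \<open>s\<close> contributes the squared norm of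
    \<open>f h\<close>.\<close>
  let ?w = "\<lambda>x. cnj (f h $ x)"
  have cnj_sum0: "(\<Sum>x\<in>UNIV. ?w x) = 0"
    using f_sum0[OF assms(6)] by (simp flip: cnj_sum)
  have sh: "(\<Sum>x\<in>UNIV. s x * ?w x) = hermitian_inner (f h) (f h)"
  proof -
    have "(\<Sum>x\<in>UNIV. s x * ?w x) = (\<Sum>l\<in>S. hermitian_inner (f l) (f h))"
      by (simp add: s_def hermitian_inner_def sum_distrib_right sum.swap[of _ S])
    also have "\<dots> = (\<Sum>l\<in>S. if l = h then hermitian_inner (f h) (f h) else 0)"
    proof (intro sum.cong refl)
      fix l assume "l \<in> S"
      then show "hermitian_inner (f l) (f h) = (if l = h then hermitian_inner (f h) (f h) else 0)"
        using S(3) assms(6) f(2) orth[of l h "f l" "f h"] by simp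
    qed
    finally show ?thesis
      using S assms(6) by simp
  qed
  \<comment> \<open>This is where the Krein condition enters: every product of components indexed by
    \<open>S\<close> is orthogonal to \<open>f h\<close>.\<close>
  have ssh: "(\<Sum>x\<in>UNIV. s x * s x * ?w x) = 0"
  proof -
    have triple0: "(\<Sum>x\<in>UNIV. f i $ x * f j $ x * ?w x) = 0" if "i \<in> S" "j \<in> S" for i j
      using that S f(2) assms(6,7)
      by (intro krein_parameter_zero[where d = d and V = V and q = q and i = i and j = j and h = h]
          sub assms(3)) (auto intro: orth)
    have "(\<Sum>x\<in>UNIV. s x * s x * ?w x) = (\<Sum>x\<in>UNIV. \<Sum>i\<in>S. \<Sum>j\<in>S. f i $ x * f j $ x * ?w x)"
      unfolding s_def sum_product unfolding sum_distrib_right ..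
    also have "\<dots> = (\<Sum>i\<in>S. \<Sum>j\<in>S. \<Sum>x\<in>UNIV. f i $ x * f j $ x * ?w x)"
      by (subst sum.swap, rule sum.cong[OF refl], rule sum.swap)
    finally show ?thesis
      by (simp add: triple0)
  qed
  \<comment> \<open>An indicator takes only the values 0 and 1, so it equals its own square.\<close>
  have "c + s x = c * c + 2 * c * s x + s x * s x" for x
  proof -
    have "c + s x = (c + s x) * (c + s x)"
      unfolding chi[symmetric] by (simp add: indicator_def)
    then show ?thesis
      by (simp add: algebra_simps)
  qed
  then have "(c + s x) * ?w x = c * c * ?w x + 2 * c * (s x * ?w x) + s x * s x * ?w x" for x
    by (simp only: distrib_right mult.assoc)
  then have "(\<Sum>x\<in>UNIV. (c + s x) * ?w x) =
      (\<Sum>x\<in>UNIV. c * c * ?w x + 2 * c * (s x * ?w x) + s x * s x * ?w x)"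
    by simp
  then have "hermitian_inner (f h) (f h) = 2 * c * hermitian_inner (f h) (f h)"
    by (simp add: sum.distrib distrib_right sh ssh cnj_sum0 flip: sum_distrib_left)
  then consider "f h = 0" | "c = 1 / 2"
    by (auto simp: hermitian_inner_self_eq_0_iff field_simps)
  then show ?thesis
  proof cases
    case 1
    \<comment> \<open>The summand for \<open>h\<close> is zero, so the same family \<open>f\<close>
      witnesses membership without it.\<close>
    have "(\<Sum>l\<in>insert 0 S. f l) = (\<Sum>l\<in>insert 0 (S - {h}). f l)"
      using 1 S by (intro sum.mono_neutral_right) auto
    with f show ?thesis
      unfolding subspace_sum_def by auto
  next
    case 2
    with card have "complex_of_real (real (card \<theta>)) = complex_of_real (1 / 2 * real CARD('a))"
      by simp
    then show ?thesis
      unfolding of_real_eq_iff ..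
  qed
qed

end
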